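(* Let $C$ be a nonempty closed convex subset of a real uniformly smooth and uniformly convex Banach space $E$, and let $T_1,\dots,T_N : C\to C$ be a finite family of asymptotically quasi $\phi$-nonexpansive mappings with a common sequence $\{k_n\}_{n\ge1}\subset[1,+\infty)$, $k_n\to1$. Suppose that $T_1,\dots,T_N$ are uniformly $L$-Lipschitz continuous for some $L>0$, and that the set $F=\bigcap_{i=1}^N F(T_i)$ is nonempty and bounded in $C$, i.e. $F\subset\Omega:=\{u\in C:\|u\|\le\omega\}$ for some positive $\omega$. Let $\{\alpha_n\}_{n\ge1}$ be a sequence in $[0,1]$ with $\lim_{n\to\infty}\alpha_n=0$. For $n\ge1$ write $n=(p_n-1)N+j_n$ with $j_n\in\{1,\dots,N\}$ and $p_n\in\{1,2,\dots\}$. Let $\{x_n\}$ be the sequence generated by $x_1\in C_1=Q_1:=C$ and $$y_n=J^{-1}\left(\alpha_nJx_1+(1-\alpha_n)JT_{j_n}^{p_n}x_n\right),\quad n\ge 1,$$ $$C_n=\{v\in C:\phi(v,y_n)\le\alpha_n\phi(v,x_1)+(1-\alpha_n)\phi(v,x_n)+\epsilon_n\},\quad n\ge2,$$ $$Q_n=\{v\in Q_{n-1}:\langle Jx_1-Jx_n,\,x_n-v\rangle\ge0\},\quad n\ge2,$$ $$x_{n+1}=\Pi_{C_n\cap Q_n}x_1,\quad n\ge1,$$ where $\epsilon_n=(k_{p_n}-1)(\omega+\|x_n\|)^2$. Then $\{x_n\}$ converges strongly to $x^\dagger:=\Pi_Fx_1$.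
   Context: Let $E$ be a smooth, strictly convex, reflexive real Banach space with dual $E^*$. $J:E\to E^*$ is the normalized duality mapping: $J(x)$ is the unique $f\in E^*$ with $\langle f,x\rangle=\|x\|^2=\|f\|^2$; it is a bijection. The Lyapunov functional is $\phi(x,y)=\|x\|^2-2\langle x,Jy\rangle+\|y\|^2$ for $x,y\in E$. For a nonempty closed convex $K\subset E$, the generalized projection $\Pi_K:E\to K$ is $\Pi_K(x)=\arg\min_{y\in K}\phi(y,x)$. For $T:C\to C$, $F(T)$ is the set of fixed points of $T$ and $T^n$ is the $n$-th iterate. $T$ is asymptotically quasi $\phi$-nonexpansive with sequence $\{k_n\}\subset[1,+\infty)$, $k_n\to1$, if $F(T)\neq\emptyset$ and $\phi(p,T^nx)\le k_n\phi(p,x)$ for all $n\ge1$, $p\in F(T)$, $x\in C$. $T$ is uniformly $L$-Lipschitz continuous ($L>0$) if $\|T^nx-T^ny\|\le L\|x-y\|$ for all $n\ge1$ and $x,y\in C$. *)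

theory Defs
  imports "HOL-Analysis.Analysis"
begin

definition uniformly_convex :: "'a::real_normed_vector itself \<Rightarrow> bool" where
  "uniformly_convex _ \<longleftrightarrow>
    (\<forall>\<epsilon>>0. \<exists>\<delta>>0. \<forall>x y :: 'a.
       norm x = 1 \<and> norm y = 1 \<and> norm (x - y) \<ge> \<epsilon> \<longrightarrow> norm ((x + y) /\<^sub>R 2) \<le> 1 - \<delta>)"

definition uniformly_smooth :: "'a::real_normed_vector itself \<Rightarrow> bool" where
  "uniformly_smooth _ \<longleftrightarrow>
    (\<exists>g :: 'a \<times> 'a \<Rightarrow> real.
       uniform_limit (sphere 0 1 \<times> sphere 0 1)
         (\<lambda>t (x, y). (norm (x + t *\<^sub>R y) - norm x) / t) g (at 0))"

text \<open>The dual space is the type of bounded linear functionals with the operator norm.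
  The functional below exists and is unique when the space is smooth; outside that
  setting the value of the description is unspecified.\<close>

definition duality_map :: "'a::real_normed_vector \<Rightarrow> ('a \<Rightarrow>\<^sub>L real)" where
  "duality_map x =
    (THE f. blinfun_apply f x = (norm x)\<^sup>2 \<and> (norm x)\<^sup>2 = (norm f)\<^sup>2)"

definition lyapunov :: "'a::real_normed_vector \<Rightarrow> 'a \<Rightarrow> real" where
  "lyapunov x y = (norm x)\<^sup>2 - 2 * blinfun_apply (duality_map y) x + (norm y)\<^sup>2"

text \<open>The minimizer is taken in the first argument of the (non-symmetric) Lyapunov
  functional. It exists and is unique for nonempty closed convex sets in a smooth,
  strictly convex, reflexive Banach space.\<close>

definition generalized_projection :: "'a::real_normed_vector set \<Rightarrow> 'a \<Rightarrow> 'a" where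
  "generalized_projection K x = arg_min_on (\<lambda>y. lyapunov y x) K"

definition fixed_points :: "'a set \<Rightarrow> ('a \<Rightarrow> 'a) \<Rightarrow> 'a set" where
  "fixed_points C T = {x \<in> C. T x = x}"

definition asymptotically_quasi_phi_nonexpansive ::
    "'a::real_normed_vector set \<Rightarrow> ('a \<Rightarrow> 'a) \<Rightarrow> (nat \<Rightarrow> real) \<Rightarrow> bool" where
  "asymptotically_quasi_phi_nonexpansive C T k \<longleftrightarrow>
    (\<forall>n\<ge>1. 1 \<le> k n) \<and> k \<longlonglongrightarrow> 1 \<and> fixed_points C T \<noteq> {} \<and>
    (\<forall>n\<ge>1. \<forall>p\<in>fixed_points C T. \<forall>x\<in>C.
       lyapunov p ((T ^^ n) x) \<le> k n * lyapunov p x)"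

definition uniformly_Lipschitz :: "real \<Rightarrow> 'a::metric_space set \<Rightarrow> ('a \<Rightarrow> 'a) \<Rightarrow> bool" where
  "uniformly_Lipschitz L C T \<longleftrightarrow> (\<forall>n\<ge>1. L-lipschitz_on C (T ^^ n))"

end

theory Submission
  imports Defs
begin

text \<open>
  Uniform convexity makes the squared norm uniformly convex on balls. Hence minimizing sequences
  of \<open>\<lambda>v. (norm v)\<^sup>2 - 2 * f v\<close> are Cauchy, which gives generalized projections and surjectivity of
  the duality map without any appeal to reflexivity, and \<open>lyapunov u v\<close> small forces \<open>u\<close> and \<open>v\<close>
  to be close. Smoothness is only used through the directional derivatives of the squared norm:
  half of this derivative is the duality map, so that no Hahn--Banach theorem is needed.

  Since \<open>x n\<close> is the projection of \<open>x 1\<close> to \<open>Qs n\<close>, the values \<open>lyapunov (x n) (x 1)\<close> increase,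
  are bounded by those at points of \<open>F\<close>, and their increments dominate \<open>lyapunov (x m) (x n)\<close>.
  So \<open>x\<close> converges to some \<open>q\<close>. Membership of \<open>x (n + 1)\<close> in \<open>Cs n\<close> gives \<open>y n \<longlonglongrightarrow> q\<close>, then
  \<open>(T (j n) ^^ p n) (x n) \<longlonglongrightarrow> q\<close>, and along each residue class the Lipschitz condition yields
  \<open>(T i ^^ m) q \<longlonglongrightarrow> q\<close>, that is, \<open>T i q = q\<close>.
\<close>

subsection \<open>Uniform convexity\<close>

text \<open>Two mechanisms supply the gap \<open>d\<close>. If the norms differ by at least
  \<open>\<eta>\<close>, convexity of the square on the reals suffices. Otherwise \<open>y\<close>
  is rescaled to the norm of \<open>x\<close>, and uniform convexity applies after division by that
  norm.\<close>

lemma uniformly_convex_power2: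
  fixes e R :: real
  assumes uc: "uniformly_convex TYPE('a::real_normed_vector)" and "e > 0" "R > 0"
  obtains d where "d > 0"
    and "\<And>x y :: 'a. \<lbrakk>norm x \<le> R; norm y \<le> R; norm (x - y) \<ge> e\<rbrakk>
      \<Longrightarrow> (norm ((x + y) /\<^sub>R 2))\<^sup>2 \<le> ((norm x)\<^sup>2 + (norm y)\<^sup>2) / 2 - d"
proof -
  have "e / (2 * R) > 0" using assms by simp
  then obtain \<delta> where \<delta>: "\<delta> > 0" and conv: "\<And>x y :: 'a. \<lbrakk>norm x = 1; norm y = 1;
      norm (x - y) \<ge> e / (2 * R)\<rbrakk> \<Longrightarrow> norm ((x + y) /\<^sub>R 2) \<le> 1 - \<delta>"
    using uc unfolding uniformly_convex_def by meson
  \<comment> \<open>The bound \<open>e / 4\<close> keeps both norms positive and the rescaled pair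
    at distance at least \<open>e / 2\<close>. The bound \<open>e * \<delta> / 4\<close> lets the
    rescaling consume at most half of the gain \<open>e * \<delta> / 2\<close>.\<close>
  define \<eta> where "\<eta> = min (e / 4) (e * \<delta> / 4)"
  define d where "d = min (\<eta>\<^sup>2 / 4) ((e * \<delta> / 4)\<^sup>2)"
  have \<eta>: "\<eta> > 0" "\<eta> \<le> e / 4" "\<eta> \<le> e * \<delta> / 4" using assms \<delta> by (auto simp: \<eta>_def)
  have "d > 0" using assms \<delta> \<eta> by (auto simp: d_def)
  have ordered: "(norm ((x + y) /\<^sub>R 2))\<^sup>2 \<le> ((norm x)\<^sup>2 + (norm y)\<^sup>2) / 2 - d"
    if xR: "norm x \<le> R" and xy: "norm y \<le> norm x" and ge: "norm (x - y) \<ge> e" for x y :: 'a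
  proof -
    define a b s where "a = norm x" and "b = norm y" and "s = norm ((x + y) /\<^sub>R 2)"
    have "0 \<le> b" "0 \<le> s" "b \<le> a" using xy by (auto simp: a_def b_def s_def)
    have "e \<le> a + b" using ge norm_triangle_ineq4[of x y] by (simp add: a_def b_def)
    have mean: "(a\<^sup>2 + b\<^sup>2) / 2 = ((a + b) / 2)\<^sup>2 + (a - b)\<^sup>2 / 4"
      by (simp add: power2_eq_square field_simps)
    show ?thesis
    proof (cases "a - b \<ge> \<eta>")
      case True
      have "s \<le> (a + b) / 2"
        using norm_triangle_ineq[of x y] by (simp add: s_def a_def b_def)
      then have "s\<^sup>2 \<le> ((a + b) / 2)\<^sup>2" using \<open>0 \<le> s\<close> by (rule power_mono)
      moreover have "\<eta>\<^sup>2 \<le> (a - b)\<^sup>2" using True \<eta> by (intro power_mono) auto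
      moreover have "d \<le> \<eta>\<^sup>2 / 4" by (simp add: d_def)
      ultimately show ?thesis using mean unfolding a_def b_def s_def by linarith
    next
      case False
      have "a \<ge> e / 2" using \<open>e \<le> a + b\<close> \<open>b \<le> a\<close> by simp
      then have "a > 0" "b > 0" using False \<eta> assms by auto
      define y' where "y' = (a / b) *\<^sub>R y"
      have y': "norm y' = a" using \<open>a > 0\<close> \<open>b > 0\<close> by (simp add: y'_def b_def)
      have "y' - y = ((a - b) / b) *\<^sub>R y"
        using \<open>b > 0\<close> by (simp add: y'_def algebra_simps diff_divide_distrib)
      then have yy: "norm (y' - y) = a - b"
        using \<open>b > 0\<close> \<open>b \<le> a\<close> by (simp add: b_def)
      have "norm (x - y) \<le> norm (x - y') + norm (y' - y)"
        using norm_triangle_ineq[of "x - y'" "y' - y"] by simp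
      then have "norm (x - y') \<ge> e / 2" using ge yy False \<eta> by simp
      then have "norm (x - y') / a \<ge> (e / 2) / R"
        using xR \<open>a > 0\<close> assms by (intro frac_le) (auto simp: a_def)
      moreover have "norm (x /\<^sub>R a - y' /\<^sub>R a) = norm (x - y') / a"
        using \<open>a > 0\<close> norm_scaleR[of "inverse a" "x - y'"]
        by (simp add: scaleR_right_diff_distrib divide_inverse mult.commute)
      ultimately have "norm ((x /\<^sub>R a + y' /\<^sub>R a) /\<^sub>R 2) \<le> 1 - \<delta>"
        using \<open>a > 0\<close> y' by (intro conv) (auto simp: a_def)
      moreover have "(x /\<^sub>R a + y' /\<^sub>R a) /\<^sub>R 2 = ((x + y') /\<^sub>R 2) /\<^sub>R a"
        by (simp add: scaleR_right_distrib)
      moreover have "norm (w /\<^sub>R a) = norm w / a" for w :: 'a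
        using \<open>a > 0\<close> by (simp add: divide_inverse mult.commute)
      ultimately have "norm ((x + y') /\<^sub>R 2) / a \<le> 1 - \<delta>" by metis
      then have mid': "norm ((x + y') /\<^sub>R 2) \<le> a * (1 - \<delta>)"
        using \<open>a > 0\<close> by (simp only: pos_divide_le_eq mult.commute)
      have "(x + y) /\<^sub>R 2 = (x + y') /\<^sub>R 2 - (y' - y) /\<^sub>R 2" by (simp add: algebra_simps)
      then have "s \<le> norm ((x + y') /\<^sub>R 2) + norm ((y' - y) /\<^sub>R 2)"
        unfolding s_def by (metis norm_triangle_ineq4)
      moreover have "norm ((y' - y) /\<^sub>R 2) = (a - b) / 2" using yy by simp
      ultimately have "s \<le> a * (1 - \<delta>) + \<eta> / 2" using mid' False by argo
      moreover have "a * \<delta> \<ge> e / 2 * \<delta>" using \<open>a \<ge> e / 2\<close> \<delta> by (intro mult_right_mono) auto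
      ultimately have "s + e * \<delta> / 4 \<le> (a + b) / 2"
        using \<eta> False by (simp add: algebra_simps)
      then have "(s + e * \<delta> / 4)\<^sup>2 \<le> ((a + b) / 2)\<^sup>2"
        using \<open>0 \<le> s\<close> \<delta> assms by (intro power_mono) auto
      moreover have "s\<^sup>2 + (e * \<delta> / 4)\<^sup>2 \<le> (s + e * \<delta> / 4)\<^sup>2"
        using \<open>0 \<le> s\<close> \<delta> assms by (simp add: power2_sum)
      moreover have "0 \<le> (a - b)\<^sup>2 / 4" by simp
      moreover have "d \<le> (e * \<delta> / 4)\<^sup>2" by (simp add: d_def)
      ultimately show ?thesis using mean unfolding a_def b_def s_def by linarith
    qed
  qed
  show thesis
  proof (rule that[OF \<open>d > 0\<close>])
    fix x y :: 'a assume "norm x \<le> R" "norm y \<le> R" "norm (x - y) \<ge> e"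
    then show "(norm ((x + y) /\<^sub>R 2))\<^sup>2 \<le> ((norm x)\<^sup>2 + (norm y)\<^sup>2) / 2 - d"
      using ordered[of x y] ordered[of y x]
      by (cases "norm y \<le> norm x") (auto simp: norm_minus_commute add.commute)
  qed
qed

lemma midpoint_in_convex:
  assumes "convex K" "u \<in> K" "v \<in> K"
  shows "(u + v) /\<^sub>R 2 \<in> K"
  using convexD[OF assms, of "1/2" "1/2"] by (simp add: scaleR_right_distrib)

text \<open>The midpoint of two distinct minimizers would have a strictly smaller value, since
  \<open>f\<close> is linear and the squared norm is uniformly convex on a ball containing
  both.\<close>

lemma quadratic_minimizer_unique:
  fixes f :: "'a::real_normed_vector \<Rightarrow>\<^sub>L real"
  assumes uc: "uniformly_convex TYPE('a)" and "convex K"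
    and z: "z \<in> K" "\<And>v. v \<in> K \<Longrightarrow> (norm z)\<^sup>2 - 2 * f z \<le> (norm v)\<^sup>2 - 2 * f v"
    and w: "w \<in> K" "\<And>v. v \<in> K \<Longrightarrow> (norm w)\<^sup>2 - 2 * f w \<le> (norm v)\<^sup>2 - 2 * f v"
  shows "z = w"
proof (rule ccontr)
  assume "z \<noteq> w"
  define R where "R = norm z + norm w"
  have "R > 0" using \<open>z \<noteq> w\<close> by (cases "z = 0") (auto simp: R_def add_pos_nonneg)
  obtain d where "d > 0" and d: "\<And>x y :: 'a. \<lbrakk>norm x \<le> R; norm y \<le> R; norm (x - y) \<ge> norm (z - w)\<rbrakk>
      \<Longrightarrow> (norm ((x + y) /\<^sub>R 2))\<^sup>2 \<le> ((norm x)\<^sup>2 + (norm y)\<^sup>2) / 2 - d"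
    by (rule uniformly_convex_power2[OF uc _ \<open>R > 0\<close>, of "norm (z - w)"]) (use \<open>z \<noteq> w\<close> in auto)
  have "(norm ((z + w) /\<^sub>R 2))\<^sup>2 \<le> ((norm z)\<^sup>2 + (norm w)\<^sup>2) / 2 - d"
    by (rule d) (auto simp: R_def)
  moreover have "f ((z + w) /\<^sub>R 2) = (f z + f w) / 2"
    by (simp add: blinfun.add_right blinfun.scaleR_right)
  moreover have "(z + w) /\<^sub>R 2 \<in> K" using assms by (intro midpoint_in_convex)
  ultimately show False using z(2)[of "(z + w) /\<^sub>R 2"] w(2)[of "(z + w) /\<^sub>R 2"] \<open>d > 0\<close>
    by argo
qed

text \<open>Bounds norms without square roots: a real number is at most one plus its square.\<close>

lemma le_of_power2_diff_le:
  fixes s t c :: real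
  assumes "(s - t)\<^sup>2 \<le> c"
  shows "s \<le> t + 1 + c"
  using assms zero_le_power2[of "s - t - 1/2"] by (simp add: power2_eq_square algebra_simps)

text \<open>Serves twice: with \<open>f = duality_map x\<close> the objective is
  \<open>lyapunov _ x\<close> up to a constant, and with \<open>K = UNIV\<close> the minimizer is a
  preimage of \<open>f\<close> under the duality map.\<close>

lemma quadratic_minimizer_exists:
  fixes f :: "'a::banach \<Rightarrow>\<^sub>L real"
  assumes uc: "uniformly_convex TYPE('a)" and "convex K" "closed K" "K \<noteq> {}"
  obtains z where "z \<in> K" "\<And>v. v \<in> K \<Longrightarrow> (norm z)\<^sup>2 - 2 * f z \<le> (norm v)\<^sup>2 - 2 * f v"
proof -
  define Q where "Q v = (norm v)\<^sup>2 - 2 * f v" for v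
  \<comment> \<open>Completing the square bounds the objective from below and, further on, the norms
    along a minimizing sequence.\<close>
  have coercive: "(norm v - norm f)\<^sup>2 - (norm f)\<^sup>2 \<le> Q v" for v
  proof -
    have "f v \<le> norm f * norm v" using norm_blinfun[of f v] by simp
    then show ?thesis by (simp add: Q_def power2_diff algebra_simps)
  qed
  then have "- (norm f)\<^sup>2 \<le> Q v" for v
    using order_trans[OF _ coercive[of v], of "- (norm f)\<^sup>2"] by simp
  then have bdd: "bdd_below (Q ` K)" by (rule bdd_belowI2)
  define m where "m = Inf (Q ` K)"
  have m_le: "m \<le> Q v" if "v \<in> K" for v
    unfolding m_def using that bdd by (intro cInf_lower) auto
  define r where "r n = 1 / real (Suc n)" for n
  have r: "0 < r n" "r n \<le> 1" "i \<le> n \<Longrightarrow> r n \<le> r i" for n i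
    by (auto simp: r_def intro!: divide_left_mono)
  have "\<exists>v\<in>K. Q v < m + r n" for n
  proof -
    have "Inf (Q ` K) < m + r n" using r by (simp add: m_def)
    then show ?thesis using cInf_lessD[of "Q ` K"] \<open>K \<noteq> {}\<close> by blast
  qed
  then obtain u where u: "\<And>n. u n \<in> K" "\<And>n. Q (u n) < m + r n" by metis
  define B where "B = m + 1 + (norm f)\<^sup>2"
  define R where "R = norm f + 1 + B"
  have uB: "(norm (u n) - norm f)\<^sup>2 \<le> B" for n
    using coercive[of "u n"] u(2)[of n] r(2)[of n] unfolding B_def by linarith
  have "B \<ge> 0" using uB[of 0] by (rule order_trans[OF zero_le_power2])
  then have "R > 0" by (simp add: R_def add.commute add_nonneg_pos add_pos_nonneg)
  have uR: "norm (u n) \<le> R" for n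
    using le_of_power2_diff_le[OF uB[of n]] by (simp add: R_def)
  have "Cauchy u"
  proof (rule metric_CauchyI)
    fix e :: real assume "e > 0"
    obtain d where "d > 0" and d: "\<And>x y :: 'a. \<lbrakk>norm x \<le> R; norm y \<le> R; norm (x - y) \<ge> e\<rbrakk>
        \<Longrightarrow> (norm ((x + y) /\<^sub>R 2))\<^sup>2 \<le> ((norm x)\<^sup>2 + (norm y)\<^sup>2) / 2 - d"
      by (rule uniformly_convex_power2[OF uc \<open>e > 0\<close> \<open>R > 0\<close>]) blast
    obtain M where M: "r M < d" using reals_Archimedean[OF \<open>d > 0\<close>] by (auto simp: r_def inverse_eq_divide)
    \<comment> \<open>If two late terms were \<open>e\<close> apart, the value at their midpoint
      would drop below \<open>m + r M - d\<close>, hence below the infimum \<open>m\<close>.\<close>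
    have "dist (u i) (u l) < e" if "i \<ge> M" "l \<ge> M" for i l
    proof (rule ccontr)
      assume "\<not> dist (u i) (u l) < e"
      then have "(norm ((u i + u l) /\<^sub>R 2))\<^sup>2 \<le> ((norm (u i))\<^sup>2 + (norm (u l))\<^sup>2) / 2 - d"
        by (intro d uR) (simp add: dist_norm)
      moreover have "f ((u i + u l) /\<^sub>R 2) = (f (u i) + f (u l)) / 2"
        by (simp add: blinfun.add_right blinfun.scaleR_right)
      ultimately have "Q ((u i + u l) /\<^sub>R 2) \<le> (Q (u i) + Q (u l)) / 2 - d"
        unfolding Q_def by argo
      moreover have "m \<le> Q ((u i + u l) /\<^sub>R 2)"
        using u(1) assms by (intro m_le midpoint_in_convex)
      moreover have "r i \<le> r M" "r l \<le> r M"
        using that r(3) by auto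
      ultimately show False using M u(2)[of i] u(2)[of l] by argo
    qed
    then show "\<exists>M. \<forall>i\<ge>M. \<forall>l\<ge>M. dist (u i) (u l) < e" by blast
  qed
  then obtain z where z: "u \<longlonglongrightarrow> z" by (auto simp: Cauchy_convergent_iff convergent_def)
  have "z \<in> K" using \<open>closed K\<close> u(1) z by (rule closed_sequentially)
  have "(\<lambda>n. Q (u n)) \<longlonglongrightarrow> Q z" unfolding Q_def by (intro tendsto_intros z)
  moreover have "(\<lambda>n. m + r n) \<longlonglongrightarrow> m + 0"
    using LIMSEQ_inverse_real_of_nat by (intro tendsto_intros) (simp add: r_def inverse_eq_divide)
  ultimately have "Q z \<le> m"
    using u(2) by (intro LIMSEQ_le[of _ "Q z" _ m]) (auto intro: less_imp_le)
  then have "Q z \<le> Q v" if "v \<in> K" for v using m_le[OF that] by simp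
  then show thesis using that[OF \<open>z \<in> K\<close>] unfolding Q_def by blast
qed

subsection \<open>The duality map\<close>

lemma power2_norm_convex:
  "(norm ((a + b) /\<^sub>R 2 :: 'a::real_normed_vector))\<^sup>2 \<le> ((norm a)\<^sup>2 + (norm b)\<^sup>2) / 2"
proof -
  have "norm ((a + b) /\<^sub>R 2) \<le> (norm a + norm b) / 2" using norm_triangle_ineq[of a b] by simp
  then have "(norm ((a + b) /\<^sub>R 2))\<^sup>2 \<le> ((norm a + norm b) / 2)\<^sup>2" by (intro power_mono) auto
  also have "\<dots> \<le> ((norm a)\<^sup>2 + (norm b)\<^sup>2) / 2"
    using zero_le_power2[of "norm a - norm b"] by (simp add: power2_eq_square field_simps)
  finally show ?thesis .
qed

text \<open>The difference \<open>g - f\<close> has a minimum at \<open>0\<close>. This turns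
  one-sided estimates into equalities of derivatives.\<close>

lemma DERIV_eq_if_touching:
  fixes f g :: "real \<Rightarrow> real"
  assumes "DERIV f 0 :> a" "DERIV g 0 :> b" "\<And>t. f t \<le> g t" "f 0 = g 0"
  shows "a = b"
proof -
  have "DERIV (\<lambda>t. g t - f t) 0 :> b - a" using assms by (intro derivative_intros)
  then have "b - a = 0" by (rule DERIV_local_min[of _ _ _ 1]) (use assms in auto)
  then show ?thesis by simp
qed

lemma tendsto_0_if_le:
  fixes f g :: "nat \<Rightarrow> real"
  assumes "g \<longlonglongrightarrow> 0" and le: "\<And>n. M \<le> n \<Longrightarrow> f n \<le> g n" and nonneg: "\<And>n. 0 \<le> f n"
  shows "f \<longlonglongrightarrow> 0"
proof (rule tendsto_sandwich[OF _ _ tendsto_const \<open>g \<longlonglongrightarrow> 0\<close>])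
  show "\<forall>\<^sub>F n in sequentially. f n \<le> g n" by (rule eventually_sequentiallyI) (rule le)
qed (simp add: nonneg)

lemma funcpow_in:
  assumes "T \<in> C \<rightarrow> C" "w \<in> C"
  shows "(T ^^ n) w \<in> C"
  using assms by (induction n) auto

text \<open>The Lipschitz condition for the first power makes \<open>T\<close> continuous, so
  applying \<open>T\<close> to the convergent iterates and shifting the index must give the same
  limit.\<close>

lemma iterates_limit_fixed:
  fixes T :: "'a::metric_space \<Rightarrow> 'a"
  assumes T: "T \<in> C \<rightarrow> C" and lip: "uniformly_Lipschitz L C T" and "w \<in> C"
    and lim: "(\<lambda>n. (T ^^ n) w) \<longlonglongrightarrow> w"
  shows "w \<in> fixed_points C T"
proof -
  have "L-lipschitz_on C (T ^^ 1)" using lip unfolding uniformly_Lipschitz_def by blast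
  then have "continuous_on C T" by (auto dest: lipschitz_on_continuous_on)
  then have "(\<lambda>n. T ((T ^^ n) w)) \<longlonglongrightarrow> T w"
    using lim \<open>w \<in> C\<close> by (rule continuous_on_tendsto_compose) (use funcpow_in[OF T \<open>w \<in> C\<close>] in auto)
  moreover have "(\<lambda>n. T ((T ^^ n) w)) \<longlonglongrightarrow> w" using LIMSEQ_Suc[OF lim] by simp
  ultimately have "T w = w" by (rule LIMSEQ_unique)
  then show ?thesis using \<open>w \<in> C\<close> by (simp add: fixed_points_def)
qed

context
  assumes smooth: "uniformly_smooth TYPE('a::real_normed_vector)"
begin

text \<open>Uniform smoothness speaks of unit vectors only, so \<open>x\<close> and \<open>h\<close>
  are normalized and the parameter is rescaled by \<open>b / a\<close>. Squaring covers
  \<open>x = 0\<close>, where the norm itself has a corner.\<close>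

lemma power2_norm_differentiable:
  fixes x h :: 'a
  shows "\<exists>D. DERIV (\<lambda>t. (norm (x + t *\<^sub>R h))\<^sup>2) 0 :> D"
proof (cases "x = 0 \<or> h = 0")
  case True
  have "DERIV (\<lambda>t. (norm x)\<^sup>2 + t\<^sup>2 * (norm h)\<^sup>2) 0 :> 0"
    by (auto intro!: derivative_eq_intros)
  moreover have "(\<lambda>t. (norm (x + t *\<^sub>R h))\<^sup>2) = (\<lambda>t. (norm x)\<^sup>2 + t\<^sup>2 * (norm h)\<^sup>2)"
    using True by (auto simp: power_mult_distrib)
  ultimately show ?thesis by auto
next
  case False
  define a b where "a = norm x" and "b = norm h"
  have ab: "a > 0" "b > 0" using False by (auto simp: a_def b_def)
  obtain g where g: "uniform_limit (sphere 0 1 \<times> sphere 0 1)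
         (\<lambda>t (x :: 'a, y). (norm (x + t *\<^sub>R y) - norm x) / t) g (at 0)"
    using smooth unfolding uniformly_smooth_def by blast
  have "(x /\<^sub>R a, h /\<^sub>R b) \<in> sphere 0 1 \<times> sphere 0 1" using ab by (auto simp: a_def b_def)
  from tendsto_uniform_limitI[OF g this]
  have "DERIV (\<lambda>t. norm (x /\<^sub>R a + t *\<^sub>R (h /\<^sub>R b))) 0 :> g (x /\<^sub>R a, h /\<^sub>R b)"
    by (simp add: DERIV_def)
  then have *: "DERIV (\<lambda>t. norm (x /\<^sub>R a + t *\<^sub>R (h /\<^sub>R b))) (b / a * 0) :> g (x /\<^sub>R a, h /\<^sub>R b)"
    by simp
  have "DERIV (\<lambda>t. norm (x /\<^sub>R a + (b / a * t) *\<^sub>R (h /\<^sub>R b))) 0 :> g (x /\<^sub>R a, h /\<^sub>R b) * (b / a)"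
    by (rule DERIV_chain2[where f = "\<lambda>t. norm (x /\<^sub>R a + t *\<^sub>R (h /\<^sub>R b))" and g = "\<lambda>t. b / a * t",
          OF *]) (use ab in \<open>auto intro!: derivative_eq_intros\<close>)
  from DERIV_power[OF DERIV_cmult[OF this, of a], of 2]
  obtain D where "DERIV (\<lambda>t. (a * norm (x /\<^sub>R a + (b / a * t) *\<^sub>R (h /\<^sub>R b)))\<^sup>2) 0 :> D"
    by blast
  moreover have "a * norm (x /\<^sub>R a + (b / a * t) *\<^sub>R (h /\<^sub>R b)) = norm (x + t *\<^sub>R h)" for t
  proof -
    have "x + t *\<^sub>R h = a *\<^sub>R (x /\<^sub>R a + (b / a * t) *\<^sub>R (h /\<^sub>R b))"
      using ab by (simp add: scaleR_right_distrib)
    then show ?thesis using ab by simp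
  qed
  ultimately show ?thesis by auto
qed

text \<open>The norm of \<open>f\<close> forces an affine function of slope \<open>2 * f h\<close>
  to stay below the squared norm along \<open>h\<close>, touching it at \<open>0\<close>. So the
  derivative determines \<open>f\<close>.\<close>

lemma support_functional_eq:
  fixes x h :: 'a
  assumes "blinfun_apply f x = (norm x)\<^sup>2" "norm f = norm x"
    and D: "DERIV (\<lambda>t. (norm (x + t *\<^sub>R h))\<^sup>2) 0 :> D"
  shows "D = 2 * f h"
proof -
  have "2 * f h = D"
  proof (rule DERIV_eq_if_touching[OF _ D])
    show "DERIV (\<lambda>t. (norm x)\<^sup>2 + t * (2 * f h)) 0 :> 2 * f h"
      by (auto intro!: derivative_eq_intros)
    fix t
    have "f (x + t *\<^sub>R h) \<le> norm x * norm (x + t *\<^sub>R h)"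
      using norm_blinfun[of f "x + t *\<^sub>R h"] assms by simp
    moreover have "f (x + t *\<^sub>R h) = (norm x)\<^sup>2 + t * f h"
      using assms by (simp add: blinfun.add_right blinfun.scaleR_right)
    ultimately show "(norm x)\<^sup>2 + t * (2 * f h) \<le> (norm (x + t *\<^sub>R h))\<^sup>2"
      using zero_le_power2[of "norm x - norm (x + t *\<^sub>R h)"]
      unfolding power2_diff by (simp add: algebra_simps)
  qed simp
  then show ?thesis by simp
qed

text \<open>The functional is half the directional derivative \<open>G\<close> of the squared norm
  at \<open>x\<close>; it remains to see that \<open>G\<close> is linear and bounded.\<close>

lemma support_functional_exists:
  fixes x :: 'a
  obtains f :: "'a \<Rightarrow>\<^sub>L real" where "blinfun_apply f x = (norm x)\<^sup>2" "norm f = norm x"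
proof -
  have "\<forall>h. \<exists>D. DERIV (\<lambda>t. (norm (x + t *\<^sub>R h))\<^sup>2) 0 :> D"
    using power2_norm_differentiable by blast
  from choice[OF this] obtain G
    where G: "\<And>h. DERIV (\<lambda>t. (norm (x + t *\<^sub>R h))\<^sup>2) 0 :> G h"
    by blast
  have G_scaled: "DERIV (\<lambda>t. (norm (x + (c * t) *\<^sub>R h))\<^sup>2) 0 :> c * G h" for c h
  proof -
    have "DERIV (\<lambda>t. (norm (x + t *\<^sub>R h))\<^sup>2) (c * 0) :> G h" using G by simp
    then have "DERIV (\<lambda>t. (norm (x + (c * t) *\<^sub>R h))\<^sup>2) 0 :> G h * c"
      by (rule DERIV_chain2[where f = "\<lambda>t. (norm (x + t *\<^sub>R h))\<^sup>2" and g = "\<lambda>t. c * t"])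
        (auto intro!: derivative_eq_intros)
    then show ?thesis by (simp only: mult.commute)
  qed
  have scale: "G (c *\<^sub>R h) = c * G h" for c h
    using G_scaled[of c h] by (intro DERIV_unique[OF G]) (simp add: mult.commute)
  \<comment> \<open>Midpoint convexity puts the curve along \<open>h + h'\<close> below the average
    of two curves of doubled speed; the doubling cancels the averaging in the derivative.\<close>
  have add: "G (h + h') = G h + G h'" for h h'
  proof (rule DERIV_eq_if_touching[OF G])
    show "DERIV (\<lambda>t. ((norm (x + (2 * t) *\<^sub>R h))\<^sup>2 + (norm (x + (2 * t) *\<^sub>R h'))\<^sup>2) / 2) 0 :> G h + G h'"
      by (rule DERIV_cong[OF DERIV_cdivide[OF DERIV_add[OF G_scaled[of 2 h] G_scaled[of 2 h']], of 2]])
        simp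
    fix t
    have "x + t *\<^sub>R (h + h') = ((x + (2 * t) *\<^sub>R h) + (x + (2 * t) *\<^sub>R h')) /\<^sub>R 2"
      by (simp add: algebra_simps flip: scaleR_add_left)
    then show "(norm (x + t *\<^sub>R (h + h')))\<^sup>2
        \<le> ((norm (x + (2 * t) *\<^sub>R h))\<^sup>2 + (norm (x + (2 * t) *\<^sub>R h'))\<^sup>2) / 2"
      using power2_norm_convex by metis
  qed simp
  \<comment> \<open>The subtracted term vanishes in the limit and absorbs the part of the difference
    quotient bound that depends on \<open>t\<close>, which leaves a constant bound.\<close>
  have le: "\<bar>G h\<bar> \<le> 2 * norm x * norm h" for h
  proof (rule tendsto_upperbound)
    show "((\<lambda>t. \<bar>((norm (x + t *\<^sub>R h))\<^sup>2 - (norm x)\<^sup>2) / t\<bar> - \<bar>t\<bar> * (norm h)\<^sup>2) \<longlongrightarrow> \<bar>G h\<bar>) (at 0)"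
    proof -
      have "((\<lambda>t. \<bar>((norm (x + t *\<^sub>R h))\<^sup>2 - (norm x)\<^sup>2) / t\<bar> - \<bar>t\<bar> * (norm h)\<^sup>2)
          \<longlongrightarrow> \<bar>G h\<bar> - \<bar>0\<bar> * (norm h)\<^sup>2) (at 0)"
        using G[of h] by (intro tendsto_intros) (simp add: DERIV_def)
      then show ?thesis by simp
    qed
    have "\<bar>((norm (x + t *\<^sub>R h))\<^sup>2 - (norm x)\<^sup>2) / t\<bar> - \<bar>t\<bar> * (norm h)\<^sup>2 \<le> 2 * norm x * norm h"
      if "t \<noteq> 0" for t
    proof -
      have diff: "\<bar>norm (x + t *\<^sub>R h) - norm x\<bar> \<le> \<bar>t\<bar> * norm h"
        using norm_triangle_ineq3[of "x + t *\<^sub>R h" x] by simp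
      have "\<bar>(norm (x + t *\<^sub>R h))\<^sup>2 - (norm x)\<^sup>2\<bar>
          = \<bar>norm (x + t *\<^sub>R h) - norm x\<bar> * (norm (x + t *\<^sub>R h) + norm x)"
        by (simp add: power2_eq_square square_diff_square_factored abs_mult)
      also have "\<dots> \<le> (\<bar>t\<bar> * norm h) * (2 * norm x + \<bar>t\<bar> * norm h)"
        using diff by (intro mult_mono) auto
      finally show ?thesis
        using that by (simp add: abs_divide divide_le_eq power2_eq_square algebra_simps)
    qed
    then show "\<forall>\<^sub>F t in at 0. \<bar>((norm (x + t *\<^sub>R h))\<^sup>2 - (norm x)\<^sup>2) / t\<bar> - \<bar>t\<bar> * (norm h)\<^sup>2
        \<le> 2 * norm x * norm h"
      by (auto simp: eventually_at_filter)
  qed simp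
  have self: "G x = 2 * (norm x)\<^sup>2"
  proof (rule DERIV_unique[OF G])
    have "(norm (x + t *\<^sub>R x))\<^sup>2 = (1 + t)\<^sup>2 * (norm x)\<^sup>2" for t
    proof -
      have "x + t *\<^sub>R x = (1 + t) *\<^sub>R x" by (simp add: algebra_simps)
      then show ?thesis by (simp add: power_mult_distrib)
    qed
    then show "DERIV (\<lambda>t. (norm (x + t *\<^sub>R x))\<^sup>2) 0 :> 2 * (norm x)\<^sup>2"
      by (auto intro!: derivative_eq_intros)
  qed
  have "bounded_linear (\<lambda>h. G h / 2)"
    by (rule bounded_linear_intro[where K = "norm x"])
      (use le scale add in \<open>auto simp: field_simps\<close>)
  then have app: "blinfun_apply (Blinfun (\<lambda>h. G h / 2)) h = G h / 2" for h
    by (simp add: bounded_linear_Blinfun_apply)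
  have "norm (Blinfun (\<lambda>h. G h / 2)) \<le> norm x"
    by (rule norm_blinfun_bound) (use le in \<open>auto simp: app field_simps\<close>)
  moreover have "norm x \<le> norm (Blinfun (\<lambda>h. G h / 2))"
  proof (cases "x = 0")
    case False
    have "norm x * norm x \<le> norm (Blinfun (\<lambda>h. G h / 2)) * norm x"
      using norm_blinfun[of "Blinfun (\<lambda>h. G h / 2)" x] by (simp add: app self power2_eq_square)
    then show ?thesis using False by simp
  qed simp
  ultimately show thesis using that[of "Blinfun (\<lambda>h. G h / 2)"] by (simp add: app self)
qed

text \<open>Any functional satisfying the defining conditions is half the derivative of the squared
  norm, so the description in \<open>duality_map\<close> has exactly one witness.\<close>

lemma duality_map_props:
  fixes x :: 'a
  shows duality_map_self: "duality_map x x = (norm x)\<^sup>2"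
    and norm_duality_map: "norm (duality_map x) = norm x"
    and power2_norm_has_derivative: "DERIV (\<lambda>t. (norm (x + t *\<^sub>R h))\<^sup>2) 0 :> 2 * duality_map x h"
proof -
  have "\<exists>!f :: 'a \<Rightarrow>\<^sub>L real. blinfun_apply f x = (norm x)\<^sup>2 \<and> (norm x)\<^sup>2 = (norm f)\<^sup>2"
  proof (rule ex_ex1I)
    show "\<exists>f :: 'a \<Rightarrow>\<^sub>L real. blinfun_apply f x = (norm x)\<^sup>2 \<and> (norm x)\<^sup>2 = (norm f)\<^sup>2"
      using support_functional_exists[of x] by metis
    fix f g :: "'a \<Rightarrow>\<^sub>L real"
    assume fg: "blinfun_apply f x = (norm x)\<^sup>2 \<and> (norm x)\<^sup>2 = (norm f)\<^sup>2"
      "blinfun_apply g x = (norm x)\<^sup>2 \<and> (norm x)\<^sup>2 = (norm g)\<^sup>2"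
    show "f = g"
    proof (rule blinfun_eqI)
      fix h
      obtain D where D: "DERIV (\<lambda>t. (norm (x + t *\<^sub>R h))\<^sup>2) 0 :> D"
        using power2_norm_differentiable by blast
      note norm_eq = power2_eq_imp_eq[OF conjunct2[THEN sym] norm_ge_zero norm_ge_zero]
      from support_functional_eq[OF fg(1)[THEN conjunct1] norm_eq[OF fg(1)] D]
        support_functional_eq[OF fg(2)[THEN conjunct1] norm_eq[OF fg(2)] D]
      show "f h = g h" by argo
    qed
  qed
  from theI'[OF this]
  have "duality_map x x = (norm x)\<^sup>2 \<and> (norm x)\<^sup>2 = (norm (duality_map x))\<^sup>2"
    unfolding duality_map_def .
  then show *: "duality_map x x = (norm x)\<^sup>2" "norm (duality_map x) = norm x"
    using power2_eq_imp_eq norm_ge_zero by metis+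
  obtain D where D: "DERIV (\<lambda>t. (norm (x + t *\<^sub>R h))\<^sup>2) 0 :> D"
    using power2_norm_differentiable by blast
  then show "DERIV (\<lambda>t. (norm (x + t *\<^sub>R h))\<^sup>2) 0 :> 2 * duality_map x h"
    using support_functional_eq[OF * D] by simp
qed

lemma duality_map_le: "duality_map y x \<le> norm x * norm (y :: 'a)"
  using norm_blinfun[of "duality_map y" x] by (simp add: norm_duality_map mult.commute)

lemma lyapunov_ge: "(norm x - norm y)\<^sup>2 \<le> lyapunov x (y :: 'a)"
  using duality_map_le[of y x] by (simp add: lyapunov_def power2_diff)

lemma lyapunov_le: "lyapunov x (y :: 'a) \<le> (norm x + norm y)\<^sup>2"
  using duality_map_le[of y "- x"] by (simp add: lyapunov_def power2_sum blinfun.minus_right)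

lemma lyapunov_nonneg: "0 \<le> lyapunov x (y :: 'a)"
  by (rule order_trans[OF zero_le_power2 lyapunov_ge])

text \<open>When the last term is nonnegative, as for \<open>z\<close> a projection of
  \<open>x\<close> and \<open>v\<close> in the set, this yields the generalized Pythagorean
  inequality.\<close>

lemma lyapunov_three_point:
  "lyapunov v (x :: 'a) = lyapunov v z + lyapunov z x + 2 * (duality_map x - duality_map z) (z - v)"
  by (simp add: lyapunov_def duality_map_self blinfun.diff_left blinfun.diff_right)

text \<open>Lets a small difference of dual images control the Lyapunov functional in both orders
  for bounded points.\<close>

lemma lyapunov_sym_sum:
  "lyapunov x y + lyapunov y (x :: 'a) = 2 * (duality_map x - duality_map y) (x - y)"
  by (simp add: lyapunov_def duality_map_self blinfun.diff_left blinfun.diff_right)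

text \<open>Apart from the squared norm of \<open>z\<close>, the functional is affine in
  \<open>duality_map z\<close>. That norm is also the dual norm of \<open>duality_map z\<close>, so
  its square is convex there.\<close>

lemma lyapunov_duality_convex:
  assumes "duality_map z = a *\<^sub>R duality_map x + (1 - a) *\<^sub>R duality_map y" "a \<in> {0..1}"
  shows "lyapunov v z \<le> a * lyapunov v x + (1 - a) * lyapunov v (y :: 'a)"
proof -
  have "norm z \<le> a * norm x + (1 - a) * norm y"
    using norm_triangle_ineq[of "a *\<^sub>R duality_map x" "(1 - a) *\<^sub>R duality_map y"] assms(2)
    unfolding assms(1)[symmetric] by (simp add: norm_duality_map)
  then have "(norm z)\<^sup>2 \<le> (a * norm x + (1 - a) * norm y)\<^sup>2" by (intro power_mono) auto
  also have "\<dots> = a * (norm x)\<^sup>2 + (1 - a) * (norm y)\<^sup>2 - a * (1 - a) * (norm x - norm y)\<^sup>2"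
    by (simp add: power2_eq_square algebra_simps)
  also have "\<dots> \<le> a * (norm x)\<^sup>2 + (1 - a) * (norm y)\<^sup>2"
    using assms by simp
  finally show ?thesis
    unfolding lyapunov_def assms(1)
    by (simp add: blinfun.add_left blinfun.diff_left blinfun.scaleR_left algebra_simps)
qed

text \<open>Twice the claimed quantity is the derivative of the objective from \<open>z\<close>
  towards \<open>v\<close>; were it negative, a short step inside \<open>K\<close> would lower the
  objective.\<close>

lemma quadratic_minimizer_variational:
  fixes z :: 'a and f :: "'a \<Rightarrow>\<^sub>L real"
  assumes "convex K" "z \<in> K" "v \<in> K"
    and min: "\<And>v. v \<in> K \<Longrightarrow> (norm z)\<^sup>2 - 2 * f z \<le> (norm v)\<^sup>2 - 2 * f v"
  shows "0 \<le> (f - duality_map z) (z - v)"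
proof (rule ccontr)
  assume neg: "\<not> 0 \<le> (f - duality_map z) (z - v)"
  define q where "q t = (norm (z + t *\<^sub>R (v - z)))\<^sup>2 - 2 * f (z + t *\<^sub>R (v - z))" for t
  have "DERIV (\<lambda>t. (norm (z + t *\<^sub>R (v - z)))\<^sup>2 - (2 * f z + t * (2 * f (v - z)))) 0
      :> 2 * duality_map z (v - z) - 2 * f (v - z)"
    by (intro DERIV_diff power2_norm_has_derivative) (auto intro!: derivative_eq_intros)
  then have "DERIV q 0 :> 2 * (f - duality_map z) (z - v)"
    unfolding q_def by (simp add: blinfun.add_right blinfun.scaleR_right blinfun.diff_left
        blinfun.diff_right algebra_simps)
  moreover have "2 * (f - duality_map z) (z - v) < 0" using neg by simp
  ultimately obtain \<delta> where \<delta>: "\<delta> > 0" "\<And>t. \<lbrakk>0 < t; t < \<delta>\<rbrakk> \<Longrightarrow> q t < q 0"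
    using DERIV_neg_dec_right[of q _ 0] by (metis add_0)
  define t where "t = min 1 (\<delta> / 2)"
  have t: "0 < t" "t < \<delta>" "t \<le> 1" using \<delta> by (auto simp: t_def)
  have "(1 - t) *\<^sub>R z + t *\<^sub>R v \<in> K" using t assms by (intro convexD) auto
  then have "z + t *\<^sub>R (v - z) \<in> K" by (simp add: algebra_simps)
  from min[OF this] have "q 0 \<le> q t" by (simp add: q_def)
  then show False using \<delta>(2)[OF t(1,2)] by simp
qed

context
  assumes convex: "uniformly_convex TYPE('a)"
begin

text \<open>If \<open>u\<close> and \<open>v\<close> were \<open>e\<close> apart, the Lyapunov value
  of their midpoint against \<open>v\<close> would be at most \<open>lyapunov u v / 2 - d\<close>,
  hence negative. The threshold \<open>1\<close> in \<open>min 1 d\<close> keeps \<open>v\<close> in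
  the ball to which \<open>d\<close> belongs.\<close>

lemma lyapunov_small_imp_close:
  fixes e R :: real
  assumes "e > 0"
  obtains d where "d > 0"
    and "\<And>u v :: 'a. \<lbrakk>norm u \<le> R; lyapunov u v < d\<rbrakk> \<Longrightarrow> norm (u - v) < e"
proof -
  have "\<bar>R\<bar> + 1 > 0" by simp
  then obtain d where "d > 0" and d: "\<And>x y :: 'a. \<lbrakk>norm x \<le> \<bar>R\<bar> + 1; norm y \<le> \<bar>R\<bar> + 1;
      norm (x - y) \<ge> e\<rbrakk> \<Longrightarrow> (norm ((x + y) /\<^sub>R 2))\<^sup>2 \<le> ((norm x)\<^sup>2 + (norm y)\<^sup>2) / 2 - d"
    using uniformly_convex_power2[OF convex \<open>e > 0\<close>] by blast
  show thesis
  proof (rule that[of "min 1 d"])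
    fix u v :: 'a assume u: "norm u \<le> R" and small: "lyapunov u v < min 1 d"
    have "(norm u - norm v)\<^sup>2 < 1" using lyapunov_ge[of u v] small by simp
    then have "\<bar>norm u - norm v\<bar> < 1" by (simp add: abs_square_less_1)
    then have v: "norm v \<le> \<bar>R\<bar> + 1" using u by linarith
    show "norm (u - v) < e"
    proof (rule ccontr)
      assume "\<not> norm (u - v) < e"
      then have "(norm ((u + v) /\<^sub>R 2))\<^sup>2 \<le> ((norm u)\<^sup>2 + (norm v)\<^sup>2) / 2 - d"
        using u v by (intro d) auto
      moreover have "lyapunov ((u + v) /\<^sub>R 2) v = (norm ((u + v) /\<^sub>R 2))\<^sup>2 - duality_map v u"
        by (simp add: lyapunov_def blinfun.add_right blinfun.scaleR_right duality_map_self
            field_simps del: norm_scaleR)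
      ultimately have "lyapunov ((u + v) /\<^sub>R 2) v \<le> lyapunov u v / 2 - d"
        unfolding lyapunov_def[of u] by argo
      then show False
        using lyapunov_nonneg[of "(u + v) /\<^sub>R 2" v] small \<open>d > 0\<close> by auto
    qed
  qed (use \<open>d > 0\<close> in auto)
qed

lemma lyapunov_tendsto_0_imp_close:
  fixes u v :: "nat \<Rightarrow> 'a"
  assumes "\<forall>\<^sub>F n in sequentially. norm (u n) \<le> R" "(\<lambda>n. lyapunov (u n) (v n)) \<longlonglongrightarrow> 0"
  shows "(\<lambda>n. u n - v n) \<longlonglongrightarrow> 0"
proof (rule tendsto_iff[THEN iffD2], intro allI impI)
  fix e :: real assume "e > 0"
  then obtain d where "d > 0" and d: "\<And>u v :: 'a. \<lbrakk>norm u \<le> R; lyapunov u v < d\<rbrakk> \<Longrightarrow> norm (u - v) < e"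
    using lyapunov_small_imp_close by blast
  have "\<forall>\<^sub>F n in sequentially. lyapunov (u n) (v n) < d"
    using assms(2) \<open>d > 0\<close> by (rule order_tendstoD)
  with assms(1) show "\<forall>\<^sub>F n in sequentially. dist (u n - v n) 0 < e"
    by eventually_elim (use d in auto)
qed

text \<open>For a convex combination \<open>w\<close> of fixed points, the estimates at the two
  points combine to \<open>lyapunov w ((T ^^ n) w)\<close> tending to zero, so the iterates of
  \<open>w\<close> converge to \<open>w\<close>.\<close>

lemma convex_fixed_points:
  assumes "convex C" and T: "T \<in> C \<rightarrow> C"
    and qn: "asymptotically_quasi_phi_nonexpansive C T k"
    and lip: "uniformly_Lipschitz L C T"
  shows "convex (fixed_points C (T :: 'a \<Rightarrow> 'a))"
proof (rule convexI)
  fix u v :: 'a and a b :: real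
  assume uv: "u \<in> fixed_points C T" "v \<in> fixed_points C T" and ab: "0 \<le> a" "0 \<le> b" "a + b = 1"
  define w where "w = a *\<^sub>R u + b *\<^sub>R v"
  have "w \<in> C"
    unfolding w_def using uv ab \<open>convex C\<close> by (intro convexD) (auto simp: fixed_points_def)
  \<comment> \<open>The correction in parentheses does not depend on \<open>z\<close>; taking
    \<open>z = w\<close> identifies it as \<open>- S\<close>.\<close>
  have expand: "lyapunov w z = a * lyapunov u z + b * lyapunov v z
      + ((norm w)\<^sup>2 - a * (norm u)\<^sup>2 - b * (norm v)\<^sup>2)" for z
  proof -
    have "a * (norm z)\<^sup>2 + b * (norm z)\<^sup>2 = (norm z)\<^sup>2" using ab by (simp flip: distrib_right)
    then show ?thesis
      by (simp add: lyapunov_def w_def blinfun.add_right blinfun.scaleR_right algebra_simps)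
  qed
  define S where "S = a * lyapunov u w + b * lyapunov v w"
  have S: "S = - ((norm w)\<^sup>2 - a * (norm u)\<^sup>2 - b * (norm v)\<^sup>2)"
    using expand[of w] by (simp add: S_def lyapunov_def duality_map_self)
  have up: "lyapunov w ((T ^^ n) w) \<le> (k n - 1) * S" if "n \<ge> 1" for n
  proof -
    have "lyapunov u ((T ^^ n) w) \<le> k n * lyapunov u w" "lyapunov v ((T ^^ n) w) \<le> k n * lyapunov v w"
      using qn uv \<open>w \<in> C\<close> that unfolding asymptotically_quasi_phi_nonexpansive_def by auto
    then have "a * lyapunov u ((T ^^ n) w) + b * lyapunov v ((T ^^ n) w)
        \<le> a * (k n * lyapunov u w) + b * (k n * lyapunov v w)"
      using ab by (intro add_mono mult_left_mono) auto
    also have "\<dots> = k n * S" by (simp add: S_def algebra_simps)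
    finally show ?thesis using expand[of "(T ^^ n) w"] S by (simp add: left_diff_distrib)
  qed
  have "k \<longlonglongrightarrow> 1" using qn by (simp add: asymptotically_quasi_phi_nonexpansive_def)
  then have "(\<lambda>n. (k n - 1) * S) \<longlonglongrightarrow> (1 - 1) * S" by (intro tendsto_intros)
  then have "(\<lambda>n. (k n - 1) * S) \<longlonglongrightarrow> 0" by simp
  then have "(\<lambda>n. lyapunov w ((T ^^ n) w)) \<longlonglongrightarrow> 0"
    using up lyapunov_nonneg by (rule tendsto_0_if_le)
  then have "(\<lambda>n. w - (T ^^ n) w) \<longlonglongrightarrow> 0"
    by (intro lyapunov_tendsto_0_imp_close[where R = "norm w"]) auto
  then have lim: "(\<lambda>n. (T ^^ n) w) \<longlonglongrightarrow> w"
    using tendsto_diff[OF tendsto_const[of w]] by fastforce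
  show "a *\<^sub>R u + b *\<^sub>R v \<in> fixed_points C T"
    using iterates_limit_fixed[OF T lip \<open>w \<in> C\<close> lim] unfolding w_def .
qed

end

end

subsection \<open>Generalized projections\<close>

lemma closed_halfspace_blinfun: "closed {v. blinfun_apply f v \<le> (c :: real)}"
  by (intro closed_Collect_le continuous_intros)

lemma convex_halfspace_blinfun: "convex {v. blinfun_apply f v \<le> (c :: real)}"
  by (intro convexI) (auto simp: blinfun.add_right blinfun.scaleR_right intro: convex_bound_le)

lemma tendsto_lyapunov:
  "(u \<longlongrightarrow> q) G \<Longrightarrow> ((\<lambda>n. lyapunov (u n) x) \<longlongrightarrow> lyapunov q x) G"
  unfolding lyapunov_def by (intro tendsto_intros)

text \<open>Uniqueness of the minimizer pins down the choice made by
  \<open>arg_min_on\<close>.\<close>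

lemma generalized_projection_eqI:
  fixes z x :: "'a::real_normed_vector"
  assumes uc: "uniformly_convex TYPE('a)" and "convex K"
    and z: "z \<in> K" "\<And>v. v \<in> K \<Longrightarrow> lyapunov z x \<le> lyapunov v x"
  shows "generalized_projection K x = z"
  unfolding generalized_projection_def arg_min_on_def
proof (rule arg_minI[where x = z])
  fix w assume w: "w \<in> K" "\<forall>v. v \<in> K \<longrightarrow> \<not> lyapunov v x < lyapunov w x"
  show "w = z"
  proof (rule quadratic_minimizer_unique[OF uc \<open>convex K\<close> w(1) _ z(1)])
    show "(norm w)\<^sup>2 - 2 * duality_map x w \<le> (norm v)\<^sup>2 - 2 * duality_map x v" if "v \<in> K" for v
      using w(2) that by (auto simp: lyapunov_def not_less)
    show "(norm z)\<^sup>2 - 2 * duality_map x z \<le> (norm v)\<^sup>2 - 2 * duality_map x v" if "v \<in> K" for v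
      using z(2)[OF that] by (simp add: lyapunov_def)
  qed
qed (use z in \<open>auto simp: not_less\<close>)

context
  assumes smooth: "uniformly_smooth TYPE('a::banach)" and convex: "uniformly_convex TYPE('a)"
begin

lemma generalized_projection_props:
  fixes x :: 'a
  assumes K: "convex K" "closed K" "K \<noteq> {}"
  shows generalized_projection_in: "generalized_projection K x \<in> K"
    and generalized_projection_variational: "v \<in> K \<Longrightarrow>
      0 \<le> (duality_map x - duality_map (generalized_projection K x)) (generalized_projection K x - v)"
proof -
  obtain z where z: "z \<in> K"
    "\<And>v. v \<in> K \<Longrightarrow> (norm z)\<^sup>2 - 2 * duality_map x z \<le> (norm v)\<^sup>2 - 2 * duality_map x v"
    by (rule quadratic_minimizer_exists[OF convex K]) blast
  have eq: "generalized_projection K x = z"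
    using z(2) by (intro generalized_projection_eqI[OF convex K(1) z(1)]) (simp add: lyapunov_def)
  show "generalized_projection K x \<in> K" using eq z(1) by simp
  show "0 \<le> (duality_map x - duality_map (generalized_projection K x)) (generalized_projection K x - v)"
    if "v \<in> K" unfolding eq
    by (rule quadratic_minimizer_variational[OF smooth K(1) z(1) that z(2)])
qed

text \<open>At a minimizer over the whole space the variational inequality holds in the directions
  \<open>h\<close> and \<open>- h\<close>, which forces equality.\<close>

lemma surj_duality_map: "surj (duality_map :: 'a \<Rightarrow> 'a \<Rightarrow>\<^sub>L real)"
proof (rule surj_def[THEN iffD2, rule_format])
  fix f :: "'a \<Rightarrow>\<^sub>L real"
  obtain z where z: "\<And>v. (norm z)\<^sup>2 - 2 * f z \<le> (norm v)\<^sup>2 - 2 * f v"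
    by (rule quadratic_minimizer_exists[OF convex, of UNIV f]) auto
  have nonneg: "0 \<le> (f - duality_map z) h" for h
    using quadratic_minimizer_variational[OF smooth, of UNIV z "z - h" f] z by simp
  have "(f - duality_map z) h = 0" for h
    using nonneg[of h] nonneg[of "- h"] by (simp add: blinfun.minus_right)
  then have "f = duality_map z"
    by (intro blinfun_eqI) (simp add: blinfun.diff_left)
  then show "\<exists>z. f = duality_map z" ..
qed

end

subsection \<open>Convergence of the iteration\<close>

theorem theorem5:
  fixes C :: "'a::banach set"
    and T :: "nat \<Rightarrow> 'a \<Rightarrow> 'a"
    and F :: "'a set"
    and N :: nat
    and k \<alpha> \<epsilon> :: "nat \<Rightarrow> real"
    and L \<omega> :: real
    and p j :: "nat \<Rightarrow> nat"
    and x y :: "nat \<Rightarrow> 'a"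
    and Cs Qs :: "nat \<Rightarrow> 'a set"
  assumes "uniformly_smooth TYPE('a)" and "uniformly_convex TYPE('a)"
    and "C \<noteq> {}" and "closed C" and "convex C"
    and "N \<ge> 1"
    and "\<And>i. i \<in> {1..N} \<Longrightarrow> T i \<in> C \<rightarrow> C"
    and "\<And>n. n \<ge> 1 \<Longrightarrow> 1 \<le> k n" and "k \<longlonglongrightarrow> 1"
    and "\<And>i. i \<in> {1..N} \<Longrightarrow> asymptotically_quasi_phi_nonexpansive C (T i) k"
    and "L > 0"
    and "\<And>i. i \<in> {1..N} \<Longrightarrow> uniformly_Lipschitz L C (T i)"
    and "F = (\<Inter>i\<in>{1..N}. fixed_points C (T i))"
    and "F \<noteq> {}"
    and "\<omega> > 0" and "F \<subseteq> {u \<in> C. norm u \<le> \<omega>}"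
    and "\<And>n. n \<ge> 1 \<Longrightarrow> \<alpha> n \<in> {0..1}" and "\<alpha> \<longlonglongrightarrow> 0"
    and "\<And>n. n \<ge> 1 \<Longrightarrow> p n \<ge> 1 \<and> j n \<in> {1..N} \<and> n = (p n - 1) * N + j n"
    and "\<And>n. n \<ge> 1 \<Longrightarrow> \<epsilon> n = (k (p n) - 1) * (\<omega> + norm (x n))\<^sup>2"
    and "Cs 1 = C" and "Qs 1 = C" and "x 1 \<in> C"
    and "\<And>n. n \<ge> 1 \<Longrightarrow>
      y n = inv duality_map
        (\<alpha> n *\<^sub>R duality_map (x 1) + (1 - \<alpha> n) *\<^sub>R duality_map ((T (j n) ^^ p n) (x n)))"
    and "\<And>n. n \<ge> 2 \<Longrightarrow>
      Cs n = {v \<in> C. lyapunov v (y n) \<le>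
        \<alpha> n * lyapunov v (x 1) + (1 - \<alpha> n) * lyapunov v (x n) + \<epsilon> n}"
    and "\<And>n. n \<ge> 2 \<Longrightarrow>
      Qs n = {v \<in> Qs (n - 1).
        blinfun_apply (duality_map (x 1) - duality_map (x n)) (x n - v) \<ge> 0}"
    and "\<And>n. n \<ge> 1 \<Longrightarrow> x (n + 1) = generalized_projection (Cs n \<inter> Qs n) (x 1)"
  shows "x \<longlonglongrightarrow> generalized_projection F (x 1)"
proof -
  note smooth = assms(1) and convex = assms(2) and closed_C = assms(4) and convex_C = assms(5)
    and TC = assms(7) and k_ge = assms(8) and k_lim = assms(9) and qn = assms(10)
    and lip = assms(12) and F_def = assms(13) and \<alpha> = assms(17) and \<alpha>_lim = assms(18)
    and pj = assms(19) and \<epsilon>_eq = assms(20) and C1 = assms(21) and Q1 = assms(22)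
    and x1 = assms(23) and y_eq = assms(24) and C_eq = assms(25) and Q_eq = assms(26)
    and x_eq = assms(27)
  have N: "N \<ge> 1" and F_ne: "F \<noteq> {}" and F_bound: "F \<subseteq> {u \<in> C. norm u \<le> \<omega>}"
    using assms by auto
  note J_norm = norm_duality_map[OF smooth] and phi_ge = lyapunov_ge[OF smooth]
    and phi_le = lyapunov_le[OF smooth] and phi_nonneg = lyapunov_nonneg[OF smooth]
    and phi_three = lyapunov_three_point[OF smooth]
    and phi_close = lyapunov_tendsto_0_imp_close[OF smooth convex]
  define w where "w n = (T (j n) ^^ p n) (x n)" for n
  \<comment> \<open>Surjectivity makes \<open>inv duality_map\<close> a right inverse of
    \<open>duality_map\<close>.\<close>
  have Jy: "duality_map (y n) = \<alpha> n *\<^sub>R duality_map (x 1) + (1 - \<alpha> n) *\<^sub>R duality_map (w n)"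
    if "n \<ge> 1" for n
    unfolding y_eq[OF that] w_def by (rule surj_f_inv_f[OF surj_duality_map[OF smooth convex]])
  have F_step: "lyapunov u (w n) \<le> k (p n) * lyapunov u (x n)"
    if "n \<ge> 1" "x n \<in> C" "u \<in> F" for n u
  proof -
    have "u \<in> fixed_points C (T (j n))" using that(3) pj[OF that(1)] F_def by auto
    then show ?thesis
      using qn[of "j n"] pj[OF that(1)] that(2)
      unfolding asymptotically_quasi_phi_nonexpansive_def w_def by blast
  qed

  \<comment> \<open>The sets \<open>Cs n\<close> and \<open>Qs n\<close>: closed, convex and
    containing \<open>F\<close>\<close>
  have Cs: "closed (Cs n) \<and> convex (Cs n) \<and> F \<subseteq> Cs n" if "n \<ge> 1" "x n \<in> C" for n
  proof (cases "n = 1")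
    case True
    then show ?thesis using C1 closed_C convex_C F_bound by auto
  next
    case False
    then have n2: "n \<ge> 2" using that by simp
    define g where "g = 2 *\<^sub>R (\<alpha> n *\<^sub>R duality_map (x 1) + (1 - \<alpha> n) *\<^sub>R duality_map (x n)
      - duality_map (y n))"
    define c where "c = \<alpha> n * (norm (x 1))\<^sup>2 + (1 - \<alpha> n) * (norm (x n))\<^sup>2 + \<epsilon> n - (norm (y n))\<^sup>2"
    \<comment> \<open>The weights on the right add up to one, so the square of \<open>norm v\<close>
      cancels and a half-space remains.\<close>
    have half: "lyapunov v (y n) \<le> \<alpha> n * lyapunov v (x 1) + (1 - \<alpha> n) * lyapunov v (x n) + \<epsilon> n
        \<longleftrightarrow> g v \<le> c" for v
      by (simp add: g_def c_def lyapunov_def blinfun.add_left blinfun.diff_left blinfun.scaleR_left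
          algebra_simps)
    have Cs_eq: "Cs n = C \<inter> {v. g v \<le> c}" unfolding C_eq[OF n2] half by blast
    have "u \<in> Cs n" if "u \<in> F" for u
    proof -
      have u: "u \<in> C" "norm u \<le> \<omega>" using that F_bound by auto
      have kp: "k (p n) \<ge> 1" using pj[OF \<open>n \<ge> 1\<close>] by (intro k_ge) simp
      have a: "0 \<le> \<alpha> n" "\<alpha> n \<le> 1" using \<alpha>[OF \<open>n \<ge> 1\<close>] by auto
      have "lyapunov u (y n) \<le> \<alpha> n * lyapunov u (x 1) + (1 - \<alpha> n) * lyapunov u (w n)"
        by (rule lyapunov_duality_convex[OF smooth Jy \<alpha>]) fact+
      moreover have "(1 - \<alpha> n) * lyapunov u (w n) \<le> (1 - \<alpha> n) * (k (p n) * lyapunov u (x n))"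
        using F_step[OF \<open>n \<ge> 1\<close> \<open>x n \<in> C\<close> that] a by (intro mult_left_mono) auto
      moreover have "(1 - \<alpha> n) * (k (p n) * lyapunov u (x n))
          = (1 - \<alpha> n) * lyapunov u (x n) + (1 - \<alpha> n) * ((k (p n) - 1) * lyapunov u (x n))"
        by (simp add: algebra_simps)
      moreover have "(1 - \<alpha> n) * ((k (p n) - 1) * lyapunov u (x n))
          \<le> 1 * ((k (p n) - 1) * lyapunov u (x n))"
        using a kp phi_nonneg[of u "x n"] by (intro mult_right_mono mult_nonneg_nonneg) auto
      \<comment> \<open>This is the purpose of the slack \<open>\<epsilon> n\<close>: the bound
        \<open>\<omega>\<close> on \<open>F\<close> controls the excess caused by
        \<open>k (p n)\<close> for all \<open>u\<close> in \<open>F\<close> at once.\<close>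
      moreover have "(k (p n) - 1) * lyapunov u (x n) \<le> \<epsilon> n"
      proof -
        have "lyapunov u (x n) \<le> (norm u + norm (x n))\<^sup>2" by (rule phi_le)
        also have "\<dots> \<le> (\<omega> + norm (x n))\<^sup>2" using u by (intro power_mono) auto
        finally show ?thesis
          unfolding \<epsilon>_eq[OF \<open>n \<ge> 1\<close>] using kp by (intro mult_left_mono) auto
      qed
      ultimately show "u \<in> Cs n" unfolding C_eq[OF n2] using u by auto
    qed
    then show ?thesis
      unfolding Cs_eq using closed_C convex_C
      by (auto intro!: closed_Int convex_Int closed_halfspace_blinfun convex_halfspace_blinfun)
  qed

  have iter_step: "x (n + 1) \<in> Cs n \<inter> Qs n \<and> x (n + 1) \<in> C \<and> Qs (n + 1) \<subseteq> Qs n \<and> closed (Qs (n + 1))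
      \<and> convex (Qs (n + 1)) \<and> F \<subseteq> Qs (n + 1)"
    if "n \<ge> 1" "x n \<in> C" "closed (Qs n)" "convex (Qs n)" "F \<subseteq> Qs n" "Qs n \<subseteq> C" for n
  proof -
    define K where "K = Cs n \<inter> Qs n"
    have FK: "F \<subseteq> K" and K: "convex K" "closed K" "K \<noteq> {}"
      using Cs[OF that(1,2)] that F_ne unfolding K_def by (auto intro!: convex_Int)
    have x_proj: "x (n + 1) = generalized_projection K (x 1)"
      unfolding K_def by (rule x_eq[OF that(1)])
    then have xK: "x (n + 1) \<in> K" using generalized_projection_in[OF smooth convex K] by simp
    define g where "g = duality_map (x 1) - duality_map (x (n + 1))"
    have "Qs (n + 1) = {v \<in> Qs n. 0 \<le> g (x (n + 1) - v)}"
      unfolding g_def using Q_eq[of "n + 1"] that(1) by simp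
    then have Q_Suc: "Qs (n + 1) = Qs n \<inter> {v. g v \<le> g (x (n + 1))}"
      by (auto simp: blinfun.diff_right)
    \<comment> \<open>The variational inequality of the projection is the new constraint in
      \<open>Qs (n + 1)\<close>, so every point of \<open>K\<close>, and hence of \<open>F\<close>,
      satisfies it.\<close>
    have "g u \<le> g (x (n + 1))" if "u \<in> K" for u
      using generalized_projection_variational[OF smooth convex K that, of "x 1", folded x_proj]
      unfolding g_def by (simp add: blinfun.diff_right)
    then have "F \<subseteq> Qs (n + 1)" using FK that(5) unfolding Q_Suc by auto
    then show ?thesis
      using xK that unfolding K_def Q_Suc
      by (auto intro!: closed_Int convex_Int closed_halfspace_blinfun convex_halfspace_blinfun)
  qed
  \<comment> \<open>One joint induction, because the projection lands in
    \<open>Cs n \<inter> Qs n\<close> only once \<open>F\<close> is known to make this intersection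
    nonempty.\<close>
  have inv: "x n \<in> C \<and> closed (Qs n) \<and> convex (Qs n) \<and> F \<subseteq> Qs n \<and> Qs n \<subseteq> C" if "n \<ge> 1" for n
    using that
  proof (induction n rule: dec_induct)
    case base
    show ?case using x1 Q1 closed_C convex_C F_bound by auto
  next
    case (step n)
    show ?case using iter_step[OF step(1)] step(3) unfolding Suc_eq_plus1 by blast
  qed
  have x_Suc: "x (n + 1) \<in> Cs n" "x (n + 1) \<in> Qs n" and Q_Suc: "Qs (n + 1) \<subseteq> Qs n"
    if "n \<ge> 1" for n
    using iter_step[of n] inv[OF that] that by blast+
  have Q_anti: "Qs m \<subseteq> Qs n" if "n \<ge> 1" "n \<le> m" for n m
    using that(2)
  proof (induction m rule: dec_induct)
    case (step m)
    then show ?case using Q_Suc[of m] that(1) by auto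
  qed simp

  \<comment> \<open>Monotone Lyapunov values and convergence of \<open>x\<close>\<close>
  have pyth: "lyapunov v (x n) + lyapunov (x n) (x 1) \<le> lyapunov v (x 1)"
    if "n \<ge> 2" "v \<in> Qs n" for n v
    using that(2) phi_three[of v "x 1" "x n"] unfolding Q_eq[OF that(1)] by simp
  \<comment> \<open>Later iterates lie in \<open>Qs n\<close>, so \<open>pyth\<close> applies to
    them. The index starts at \<open>2\<close> because \<open>Qs 1 = C\<close> carries no
    inequality.\<close>
  have incr: "lyapunov (x m) (x n) \<le> lyapunov (x m) (x 1) - lyapunov (x n) (x 1)"
    if "n \<ge> 2" "n < m" for n m
  proof -
    have "x m \<in> Qs (m - 1)" using x_Suc(2)[of "m - 1"] that by simp
    moreover have "Qs (m - 1) \<subseteq> Qs n" using that by (intro Q_anti) auto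
    ultimately have "x m \<in> Qs n" by blast
    then show ?thesis using pyth[OF that(1)] by fastforce
  qed
  define r where "r n = lyapunov (x n) (x 1)" for n
  have r_le: "r n \<le> lyapunov u (x 1)" if "n \<ge> 2" "u \<in> F" for n u
  proof -
    have "u \<in> Qs n" using inv[of n] that by auto
    then show ?thesis using pyth[OF that(1), of u] phi_nonneg[of u "x n"] by (simp add: r_def)
  qed
  obtain u where u: "u \<in> F" using F_ne by blast

  obtain q where q: "x \<longlonglongrightarrow> q"
  proof -
    define z where "z n = x (n + 2)" for n
    define B where "B = norm (x 1) + 1 + lyapunov u (x 1)"
    have "norm (x n) \<le> B" if "n \<ge> 2" for n
      unfolding B_def using phi_ge[of "x n" "x 1"] r_le[OF that u]
      by (intro le_of_power2_diff_le) (simp add: r_def)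
    then have zB: "norm (z n) \<le> B" for n by (simp add: z_def)
    have "incseq (\<lambda>n. r (n + 2))"
    proof (rule incseq_SucI)
      fix n
      show "r (n + 2) \<le> r (Suc n + 2)"
        using incr[of "n + 2" "Suc n + 2"] phi_nonneg[of "x (Suc n + 2)" "x (n + 2)"]
        by (simp add: r_def)
    qed
    moreover have "\<forall>n. r (n + 2) \<le> lyapunov u (x 1)" using r_le u by simp
    ultimately obtain l where "(\<lambda>n. r (n + 2)) \<longlonglongrightarrow> l" using incseq_convergent by blast
    then have r_Cauchy: "Cauchy (\<lambda>n. r (n + 2))" by (rule LIMSEQ_imp_Cauchy)
    have "Cauchy z"
    proof (rule metric_CauchyI)
      fix e :: real assume "e > 0"
      obtain d where "d > 0" and d: "\<And>u v :: 'a. \<lbrakk>norm u \<le> B; lyapunov u v < d\<rbrakk> \<Longrightarrow> norm (u - v) < e"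
        by (rule lyapunov_small_imp_close[OF smooth convex \<open>e > 0\<close>, of B]) blast
      obtain M where M: "\<And>m n. \<lbrakk>m \<ge> M; n \<ge> M\<rbrakk> \<Longrightarrow> dist (r (m + 2)) (r (n + 2)) < d"
        using metric_CauchyD[OF r_Cauchy \<open>d > 0\<close>] by blast
      have ordered: "dist (z m) (z n) < e" if "n < m" "n \<ge> M" for m n
      proof -
        have "lyapunov (z m) (z n) \<le> r (m + 2) - r (n + 2)"
          using incr[of "n + 2" "m + 2"] that by (simp add: z_def r_def)
        also have "\<dots> < d" using M[of m n] that by (simp add: dist_real_def)
        finally show ?thesis using d[OF zB] by (simp add: dist_norm)
      qed
      have "dist (z m) (z n) < e" if "m \<ge> M" "n \<ge> M" for m n
        using ordered[of n m] ordered[of m n] that \<open>e > 0\<close>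
        by (cases m n rule: linorder_cases) (auto simp: dist_commute)
      then show "\<exists>M. \<forall>m\<ge>M. \<forall>n\<ge>M. dist (z m) (z n) < e" by blast
    qed
    then obtain q where "z \<longlonglongrightarrow> q" by (auto simp: Cauchy_convergent_iff convergent_def)
    then have "x \<longlonglongrightarrow> q" unfolding z_def by (rule LIMSEQ_offset)
    then show thesis by (rule that)
  qed
  have x_Suc_lim: "(\<lambda>n. x (n + 1)) \<longlonglongrightarrow> q" using q by (rule LIMSEQ_ignore_initial_segment)
  have r_lim: "r \<longlonglongrightarrow> lyapunov q (x 1)" unfolding r_def by (rule tendsto_lyapunov[OF q])
  have r_Suc_lim: "(\<lambda>n. r (n + 1)) \<longlonglongrightarrow> lyapunov q (x 1)"
    using r_lim by (rule LIMSEQ_ignore_initial_segment)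
  have "q \<in> C"
  proof (rule closed_sequentially[OF closed_C _ x_Suc_lim])
    show "x (n + 1) \<in> C" for n using inv[of "n + 1"] by simp
  qed
  obtain R where R: "\<And>n. norm (x n) \<le> R"
    using convergent_imp_Bseq[OF convergentI[OF q]] by (auto simp: Bseq_def)

  \<comment> \<open>Vanishing of the error terms\<close>
  have "filterlim p at_top sequentially"
    unfolding filterlim_at_top
  proof (rule allI, rule eventually_sequentiallyI)
    fix Z n assume n: "Z * N + 1 \<le> n"
    then have "n = (p n - 1) * N + j n" "j n \<le> N" "p n \<ge> 1" using pj[of n] by auto
    then have "n \<le> (p n - 1) * N + N" by linarith
    also have "\<dots> = p n * N" using \<open>p n \<ge> 1\<close> by (cases "p n") auto
    finally have "Z * N < p n * N" using n by linarith
    then show "Z \<le> p n" by simp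
  qed
  then have kp_lim: "(\<lambda>n. k (p n)) \<longlonglongrightarrow> 1" by (rule filterlim_compose[OF k_lim])
  have "(\<lambda>n. (k (p n) - 1) * (\<omega> + norm (x n))\<^sup>2) \<longlonglongrightarrow> (1 - 1) * (\<omega> + norm q)\<^sup>2"
    by (intro tendsto_intros kp_lim q)
  then have "(\<lambda>n. (k (p n) - 1) * (\<omega> + norm (x n))\<^sup>2) \<longlonglongrightarrow> 0" by simp
  then have \<epsilon>_lim: "\<epsilon> \<longlonglongrightarrow> 0"
    by (rule Lim_transform_eventually) (auto intro!: eventually_sequentiallyI[of 1] simp: \<epsilon>_eq)

  \<comment> \<open>Convergence of \<open>y\<close> and of the iterated images
    \<open>w\<close>\<close>
  have "(\<lambda>n. x (n + 1) - y n) \<longlonglongrightarrow> 0"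
  proof (rule phi_close)
    have "(\<lambda>n. \<alpha> n * r (n + 1) + (1 - \<alpha> n) * (r (n + 1) - r n) + \<epsilon> n) \<longlonglongrightarrow>
        0 * lyapunov q (x 1) + (1 - 0) * (lyapunov q (x 1) - lyapunov q (x 1)) + 0"
      by (intro tendsto_intros \<alpha>_lim r_lim r_Suc_lim \<epsilon>_lim)
    then have lim: "(\<lambda>n. \<alpha> n * r (n + 1) + (1 - \<alpha> n) * (r (n + 1) - r n) + \<epsilon> n) \<longlonglongrightarrow> 0" by simp
    \<comment> \<open>Membership of \<open>x (n + 1)\<close> in \<open>Cs n\<close> is combined with
      \<open>incr\<close>; again \<open>n \<ge> 2\<close>, since \<open>Cs 1 = C\<close> carries no
      inequality.\<close>
    have le: "lyapunov (x (n + 1)) (y n)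
        \<le> \<alpha> n * r (n + 1) + (1 - \<alpha> n) * (r (n + 1) - r n) + \<epsilon> n" if "n \<ge> 2" for n
    proof -
      have "lyapunov (x (n + 1)) (y n)
          \<le> \<alpha> n * r (n + 1) + (1 - \<alpha> n) * lyapunov (x (n + 1)) (x n) + \<epsilon> n"
        using x_Suc(1)[of n] that unfolding C_eq[OF that] r_def by simp
      moreover have "(1 - \<alpha> n) * lyapunov (x (n + 1)) (x n) \<le> (1 - \<alpha> n) * (r (n + 1) - r n)"
        using incr[of n "n + 1"] \<alpha>[of n] that unfolding r_def by (intro mult_left_mono) auto
      ultimately show ?thesis by simp
    qed
    show "(\<lambda>n. lyapunov (x (n + 1)) (y n)) \<longlonglongrightarrow> 0"
      by (rule tendsto_0_if_le[OF lim], erule le, rule phi_nonneg)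
    show "\<forall>\<^sub>F n in sequentially. norm (x (n + 1)) \<le> R" using R by simp
  qed
  from tendsto_diff[OF x_Suc_lim this] have y_lim: "y \<longlonglongrightarrow> q" by simp
  obtain Ry where Ry: "\<And>n. norm (y n) \<le> Ry"
    using convergent_imp_Bseq[OF convergentI[OF y_lim]] by (auto simp: Bseq_def)
  obtain Rk where Rk: "\<And>n. norm (k (p n)) \<le> Rk"
    using convergent_imp_Bseq[OF convergentI[OF kp_lim]] by (auto simp: Bseq_def)
  \<comment> \<open>The estimate at the common fixed point \<open>u\<close> keeps \<open>w\<close>
    in a ball before its convergence is known.\<close>
  define Rw where "Rw = norm u + 1 + Rk * (norm u + R)\<^sup>2"
  have w_bound: "norm (w n) \<le> Rw" if "n \<ge> 1" for n
    unfolding Rw_def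
  proof (rule le_of_power2_diff_le)
    have "(norm (w n) - norm u)\<^sup>2 = (norm u - norm (w n))\<^sup>2" by (rule power2_commute)
    also have "\<dots> \<le> lyapunov u (w n)" by (rule phi_ge)
    also have "\<dots> \<le> k (p n) * lyapunov u (x n)" using inv[OF that] by (intro F_step that u) auto
    also have "\<dots> \<le> Rk * (norm u + R)\<^sup>2"
    proof (rule mult_mono)
      show "k (p n) \<le> Rk" "0 \<le> Rk" using Rk[of n] by auto
      show "lyapunov u (x n) \<le> (norm u + R)\<^sup>2"
        using R[of n] by (intro order_trans[OF phi_le] power_mono) auto
    qed (rule phi_nonneg)
    finally show "(norm (w n) - norm u)\<^sup>2 \<le> Rk * (norm u + R)\<^sup>2" .
  qed

  have "(\<lambda>n. w n - y n) \<longlonglongrightarrow> 0"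
  proof (rule phi_close)
    show "\<forall>\<^sub>F n in sequentially. norm (w n) \<le> Rw" using w_bound by (rule eventually_sequentiallyI)
    define c where "c = 2 * ((R + Rw) * (Ry + Rw))"
    have le: "lyapunov (w n) (y n) \<le> \<alpha> n * c" if "n \<ge> 1" for n
    proof -
      have a: "0 \<le> \<alpha> n" using \<alpha>[OF that] by simp
      \<comment> \<open>The dual images of \<open>y n\<close> and \<open>w n\<close> differ by
        \<open>\<alpha> n\<close> times a bounded functional, so the symmetrized Lyapunov value is
        at most a constant times \<open>\<alpha> n\<close>.\<close>
      have "duality_map (y n) - duality_map (w n) = \<alpha> n *\<^sub>R (duality_map (x 1) - duality_map (w n))"
        unfolding Jy[OF that] by (simp add: algebra_simps)
      then have "lyapunov (y n) (w n) + lyapunov (w n) (y n)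
          = \<alpha> n * (2 * (duality_map (x 1) - duality_map (w n)) (y n - w n))"
        unfolding lyapunov_sym_sum[OF smooth] by (simp add: blinfun.scaleR_left)
      moreover have "(duality_map (x 1) - duality_map (w n)) (y n - w n) \<le> (R + Rw) * (Ry + Rw)"
      proof -
        have "(duality_map (x 1) - duality_map (w n)) (y n - w n)
            \<le> norm (duality_map (x 1) - duality_map (w n)) * norm (y n - w n)"
          using norm_blinfun[of "duality_map (x 1) - duality_map (w n)" "y n - w n"] by simp
        also have "\<dots> \<le> (norm (x 1) + norm (w n)) * (norm (y n) + norm (w n))"
          using norm_triangle_ineq4[of "duality_map (x 1)" "duality_map (w n)"]
          by (intro mult_mono norm_triangle_ineq4) (auto simp: J_norm)
        also have "\<dots> \<le> (R + Rw) * (Ry + Rw)"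
          using R[of 1] Ry[of n] w_bound[OF that] norm_ge_zero
          by (intro mult_mono add_mono add_nonneg_nonneg) (auto intro: order_trans[OF norm_ge_zero])
        finally show ?thesis .
      qed
      then have "\<alpha> n * (2 * (duality_map (x 1) - duality_map (w n)) (y n - w n)) \<le> \<alpha> n * c"
        unfolding c_def using a by (intro mult_left_mono) auto
      ultimately have "lyapunov (y n) (w n) + lyapunov (w n) (y n) \<le> \<alpha> n * c" by simp
      then show ?thesis using phi_nonneg[of "y n" "w n"] by simp
    qed
    have lim: "(\<lambda>n. \<alpha> n * c) \<longlonglongrightarrow> 0" using tendsto_mult_right[OF \<alpha>_lim, of c] by simp
    show "(\<lambda>n. lyapunov (w n) (y n)) \<longlonglongrightarrow> 0"
      by (rule tendsto_0_if_le[OF lim], erule le, rule phi_nonneg)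
  qed
  from tendsto_add[OF this y_lim] have w_lim: "w \<longlonglongrightarrow> q" by simp

  \<comment> \<open>The limit as a common fixed point\<close>
  have "q \<in> fixed_points C (T i)" if i: "i \<in> {1..N}" for i
  proof (rule iterates_limit_fixed[OF TC[OF i] lip[OF i] \<open>q \<in> C\<close>])
    \<comment> \<open>The indices \<open>s m\<close> are those at which \<open>T i\<close> acts; the
      power applied there is \<open>Suc m\<close>.\<close>
    define s where "s m = m * N + i" for m
    have "strict_mono s" unfolding s_def using N by (intro strict_monoI_Suc) auto
    have s1: "s m \<ge> 1" for m using i by (simp add: s_def)
    have index: "p (s m) = Suc m \<and> j (s m) = i" for m
    proof -
      define a b where "a = p (s m) - 1" and "b = j (s m)"
      have p1: "p (s m) \<ge> 1" and b: "b \<in> {1..N}" and eq: "m * N + i = a * N + b"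
        using pj[OF s1[of m]] by (auto simp: a_def b_def s_def)
      \<comment> \<open>Lowering the residues from \<open>1..N\<close> to \<open>0..N-1\<close>
        makes uniqueness of division with remainder applicable.\<close>
      have "m * N + (i - 1) = a * N + (b - 1)" "i - 1 < N" "b - 1 < N" using eq i b by auto
      then have "m = a"
        by (metis add.commute add_cancel_right_right div_less div_mult_self3 less_nat_zero_code)
      then show ?thesis using p1 eq by (auto simp: a_def b_def)
    qed
    have "(\<lambda>m. w (s m)) \<longlonglongrightarrow> q" and xs: "(\<lambda>m. x (s m)) \<longlonglongrightarrow> q"
      using LIMSEQ_subseq_LIMSEQ[OF w_lim \<open>strict_mono s\<close>] LIMSEQ_subseq_LIMSEQ[OF q \<open>strict_mono s\<close>]
      by (simp_all add: o_def)
    then have Tx: "(\<lambda>m. (T i ^^ Suc m) (x (s m))) \<longlonglongrightarrow> q" by (simp add: w_def index)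
    \<comment> \<open>Since \<open>L\<close> is the same for all powers, the moving point
      \<open>x (s m)\<close> can be replaced by \<open>q\<close> while the power grows.\<close>
    have "(\<lambda>m. dist ((T i ^^ Suc m) (x (s m))) ((T i ^^ Suc m) q)) \<longlonglongrightarrow> 0"
    proof (rule tendsto_0_if_le)
      have "(\<lambda>m. L * dist (x (s m)) q) \<longlonglongrightarrow> L * dist q q" by (intro tendsto_intros xs)
      then show "(\<lambda>m. L * dist (x (s m)) q) \<longlonglongrightarrow> 0" by simp
      show "dist ((T i ^^ Suc m) (x (s m))) ((T i ^^ Suc m) q) \<le> L * dist (x (s m)) q" for m
      proof (rule lipschitz_onD)
        show "L-lipschitz_on C (T i ^^ Suc m)"
          using lip[OF i] unfolding uniformly_Lipschitz_def by (metis le_add1 plus_1_eq_Suc)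
        show "x (s m) \<in> C" using inv[OF s1] by blast
      qed fact
    qed simp
    then have "(\<lambda>m. (T i ^^ Suc m) (x (s m)) - (T i ^^ Suc m) q) \<longlonglongrightarrow> 0"
      unfolding dist_norm by (rule tendsto_norm_zero_cancel)
    then have "(\<lambda>m. (T i ^^ Suc m) q) \<longlonglongrightarrow> q" by (rule Lim_transform2[OF Tx])
    then show "(\<lambda>m. (T i ^^ m) q) \<longlonglongrightarrow> q" by (rule LIMSEQ_imp_Suc)
  qed

  \<comment> \<open>Identification of the limit with the projection\<close>
  then have "q \<in> F" unfolding F_def by blast
  moreover have "convex F"
    unfolding F_def
    by (intro convex_INT) (rule convex_fixed_points[OF smooth convex convex_C TC qn lip])
  \<comment> \<open>Passing to the limit in \<open>r_le\<close> makes \<open>q\<close> a minimizer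
    over \<open>F\<close>; convexity of \<open>F\<close> makes it the only one.\<close>
  moreover have "lyapunov q (x 1) \<le> lyapunov v (x 1)" if "v \<in> F" for v
    using r_lim by (rule LIMSEQ_le_const2) (use r_le that in blast)
  ultimately have "generalized_projection F (x 1) = q"
    by (intro generalized_projection_eqI[OF convex])
  then show ?thesis using q by simp
qed

end
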